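(* Let $(D,\vdash,\dashv)$ be a finite-dimensional diassociative algebra. For $d\in D$ let $\lambda_d^{\vdash}:D\to D$ be the linear map $\lambda_d^{\vdash}(x)=d\vdash x$. Then $D$ is nilpotent if and only if $\lambda_d^{\vdash}$ is a nilpotent endomorphism of $D$ for every $d\in D$.
   Context: A diassociative algebra $(D,\vdash,\dashv)$ is a vector space $D$ over a field with two bilinear products $\vdash,\dashv:D\times D\to D$ satisfying, for all $x,y,z\in D$: (A1) $(x\vdash y)\vdash z=x\vdash(y\vdash z)$; (A2) $(x\dashv y)\dashv z=x\dashv(y\dashv z)$; (D1) $(x\dashv y)\vdash z=x\vdash(y\vdash z)$; (D2) $(x\dashv y)\dashv z=x\dashv(y\vdash z)$; (S1) $(x\vdash y)\dashv z=x\vdash(y\dashv z)$. For subspaces $A,B\subseteq D$, let $A\vdash B$ (resp. $A\dashv B$) be the span of all $a\vdash b$ (resp. $a\dashv b$) with $a\in A$, $b\in B$, and $A\lozenge B=A\vdash B+A\dashv B$. Set $D^1=D$ and $D^{n+1}=D^1\lozenge D^n+D^2\lozenge D^{n-1}+\cdots+D^n\lozenge D^1$ for $n\ge 1$. $D$ is nilpotent if $D^n=0$ for some $n\in\mathbb{N}$. A linear endomorphism $\lambda$ is nilpotent if its $n$-fold composite $\lambda\circ\cdots\circ\lambda$ is $0$ for some $n\in\mathbb{N}$. *)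

theory Defs
  imports Complex_Main "HOL-Library.Set_Algebras"
begin

locale diassociative_algebra = vector_space scale
  for scale :: "'k::field \<Rightarrow> 'a::ab_group_add \<Rightarrow> 'a" +
  fixes lp :: "'a \<Rightarrow> 'a \<Rightarrow> 'a" (infixl \<open>\<turnstile>\<^sub>D\<close> 70)
    and rp :: "'a \<Rightarrow> 'a \<Rightarrow> 'a" (infixl \<open>\<stileturn>\<^sub>D\<close> 70)
  assumes lp_linear_left: "Vector_Spaces.linear scale scale (\<lambda>x. x \<turnstile>\<^sub>D y)"
    and lp_linear_right: "Vector_Spaces.linear scale scale (\<lambda>y. x \<turnstile>\<^sub>D y)"
    and rp_linear_left: "Vector_Spaces.linear scale scale (\<lambda>x. x \<stileturn>\<^sub>D y)"
    and rp_linear_right: "Vector_Spaces.linear scale scale (\<lambda>y. x \<stileturn>\<^sub>D y)"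
    and A1: "(x \<turnstile>\<^sub>D y) \<turnstile>\<^sub>D z = x \<turnstile>\<^sub>D (y \<turnstile>\<^sub>D z)"
    and A2: "(x \<stileturn>\<^sub>D y) \<stileturn>\<^sub>D z = x \<stileturn>\<^sub>D (y \<stileturn>\<^sub>D z)"
    and D1: "(x \<stileturn>\<^sub>D y) \<turnstile>\<^sub>D z = x \<turnstile>\<^sub>D (y \<turnstile>\<^sub>D z)"
    and D2: "(x \<stileturn>\<^sub>D y) \<stileturn>\<^sub>D z = x \<stileturn>\<^sub>D (y \<turnstile>\<^sub>D z)"
    and S1: "(x \<turnstile>\<^sub>D y) \<stileturn>\<^sub>D z = x \<turnstile>\<^sub>D (y \<stileturn>\<^sub>D z)"
begin

definition lp_span :: "'a set \<Rightarrow> 'a set \<Rightarrow> 'a set" where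
  "lp_span A B = span {a \<turnstile>\<^sub>D b | a b. a \<in> A \<and> b \<in> B}"

definition rp_span :: "'a set \<Rightarrow> 'a set \<Rightarrow> 'a set" where
  "rp_span A B = span {a \<stileturn>\<^sub>D b | a b. a \<in> A \<and> b \<in> B}"

text \<open>Sums of subspaces, here and in \<open>Dpow\<close>, are the elementwise sums of
  \<open>Set_Algebras\<close>.\<close>

definition lozenge :: "'a set \<Rightarrow> 'a set \<Rightarrow> 'a set" (infixl \<open>\<lozenge>\<close> 70) where
  "A \<lozenge> B = lp_span A B + rp_span A B"

text \<open>The powers are indexed from 1; the value at 0 is a dummy, and
  \<open>nilpotent_algebra\<close> ignores it.\<close>

fun Dpow :: "nat \<Rightarrow> 'a set" where
  "Dpow 0 = UNIV"
| "Dpow (Suc 0) = UNIV"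
| "Dpow (Suc (Suc n)) = (\<Sum>i = 1..Suc n. Dpow i \<lozenge> Dpow (Suc (Suc n) - i))"

definition nilpotent_algebra :: bool where
  "nilpotent_algebra \<longleftrightarrow> (\<exists>n\<ge>1. Dpow n = {0})"

definition left_mult :: "'a \<Rightarrow> 'a \<Rightarrow> 'a" where
  "left_mult d = (\<lambda>x. d \<turnstile>\<^sub>D x)"

definition nilpotent_endomorphism :: "('a \<Rightarrow> 'a) \<Rightarrow> bool" where
  "nilpotent_endomorphism f \<longleftrightarrow>
     Vector_Spaces.linear scale scale f \<and> (\<exists>n\<ge>1. f ^^ n = (\<lambda>x. 0))"

end

end

theory Submission
  imports Defs
begin

text \<open>
  By the axioms, every product of \<open>n\<close> elements has the form
  \<open>x\<^sub>1 \<turnstile> (\<dots> \<turnstile> (x\<^sub>k \<stileturn> (x\<^sub>k\<^sub>+\<^sub>1 \<stileturn> \<dots> \<stileturn> x\<^sub>n)))\<close> with one central factor \<open>x\<^sub>k\<close>, and to the right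
  of the centre each \<open>\<stileturn>\<close> may be replaced by \<open>\<turnstile>\<close>. Suppose that all left words
  \<open>x\<^sub>1 \<turnstile> (\<dots> \<turnstile> (x\<^sub>N \<turnstile> z))\<close> vanish. Then all products of \<open>2 N + 1\<close> factors vanish, because either
  at least \<open>N\<close> factors lie to the left of the centre or at least \<open>N + 1\<close> to its right.

  Such an \<open>N\<close> comes from an Engel type argument. The maps \<open>z \<mapsto> d \<turnstile> z\<close> form a vector space of
  nilpotent endomorphisms closed under composition. Given a proper invariant subspace \<open>B\<close>,
  a vector \<open>w \<notin> B\<close> for which \<open>D \<turnstile> w + B\<close> has least dimension satisfies \<open>D \<turnstile> w \<subseteq> B\<close>
  (lemma \<open>ex_annihilated_modulo\<close>). Hence the subspace of the vectors that all \<open>n\<close>-fold left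
  multiplications kill grows strictly with \<open>n\<close> until it exhausts the space
  (lemma \<open>ex_left_colon_UNIV\<close>).

  Instead of normal forms of words, the proof counts the factors on the two sides of the centre
  by means of the filtration \<open>left_colon\<close> (lemmas \<open>Dpow_lp_left_colon\<close>, \<open>rp_Dpow_eq_0\<close> and
  \<open>Dpow_subset_left_colon\<close>). The converse is immediate: \<open>n - 1\<close> left multiplications map the
  algebra into its \<open>n\<close>th power.
\<close>

context diassociative_algebra
begin

section \<open>Bilinearity and powers\<close>

lemma bilinear_simps:
  "(x + y) \<turnstile>\<^sub>D z = x \<turnstile>\<^sub>D z + y \<turnstile>\<^sub>D z" "z \<turnstile>\<^sub>D (x + y) = z \<turnstile>\<^sub>D x + z \<turnstile>\<^sub>D y"
  "(x + y) \<stileturn>\<^sub>D z = x \<stileturn>\<^sub>D z + y \<stileturn>\<^sub>D z" "z \<stileturn>\<^sub>D (x + y) = z \<stileturn>\<^sub>D x + z \<stileturn>\<^sub>D y"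
  "(x - y) \<turnstile>\<^sub>D z = x \<turnstile>\<^sub>D z - y \<turnstile>\<^sub>D z" "z \<turnstile>\<^sub>D (x - y) = z \<turnstile>\<^sub>D x - z \<turnstile>\<^sub>D y"
  "(x - y) \<stileturn>\<^sub>D z = x \<stileturn>\<^sub>D z - y \<stileturn>\<^sub>D z" "z \<stileturn>\<^sub>D (x - y) = z \<stileturn>\<^sub>D x - z \<stileturn>\<^sub>D y"
  "scale c x \<turnstile>\<^sub>D z = scale c (x \<turnstile>\<^sub>D z)" "z \<turnstile>\<^sub>D scale c x = scale c (z \<turnstile>\<^sub>D x)"
  "scale c x \<stileturn>\<^sub>D z = scale c (x \<stileturn>\<^sub>D z)" "z \<stileturn>\<^sub>D scale c x = scale c (z \<stileturn>\<^sub>D x)"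
  "0 \<turnstile>\<^sub>D z = 0" "z \<turnstile>\<^sub>D 0 = 0" "0 \<stileturn>\<^sub>D z = 0" "z \<stileturn>\<^sub>D 0 = 0"
proof -
  interpret a: Vector_Spaces.linear scale scale "\<lambda>x. x \<turnstile>\<^sub>D z" by (rule lp_linear_left)
  interpret b: Vector_Spaces.linear scale scale "\<lambda>x. z \<turnstile>\<^sub>D x" by (rule lp_linear_right)
  interpret c: Vector_Spaces.linear scale scale "\<lambda>x. x \<stileturn>\<^sub>D z" by (rule rp_linear_left)
  interpret d: Vector_Spaces.linear scale scale "\<lambda>x. z \<stileturn>\<^sub>D x" by (rule rp_linear_right)
  show "(x + y) \<turnstile>\<^sub>D z = x \<turnstile>\<^sub>D z + y \<turnstile>\<^sub>D z" "z \<turnstile>\<^sub>D (x + y) = z \<turnstile>\<^sub>D x + z \<turnstile>\<^sub>D y"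
    "(x + y) \<stileturn>\<^sub>D z = x \<stileturn>\<^sub>D z + y \<stileturn>\<^sub>D z" "z \<stileturn>\<^sub>D (x + y) = z \<stileturn>\<^sub>D x + z \<stileturn>\<^sub>D y"
    "(x - y) \<turnstile>\<^sub>D z = x \<turnstile>\<^sub>D z - y \<turnstile>\<^sub>D z" "z \<turnstile>\<^sub>D (x - y) = z \<turnstile>\<^sub>D x - z \<turnstile>\<^sub>D y"
    "(x - y) \<stileturn>\<^sub>D z = x \<stileturn>\<^sub>D z - y \<stileturn>\<^sub>D z" "z \<stileturn>\<^sub>D (x - y) = z \<stileturn>\<^sub>D x - z \<stileturn>\<^sub>D y"
    "scale c x \<turnstile>\<^sub>D z = scale c (x \<turnstile>\<^sub>D z)" "z \<turnstile>\<^sub>D scale c x = scale c (z \<turnstile>\<^sub>D x)"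
    "scale c x \<stileturn>\<^sub>D z = scale c (x \<stileturn>\<^sub>D z)" "z \<stileturn>\<^sub>D scale c x = scale c (z \<stileturn>\<^sub>D x)"
    "0 \<turnstile>\<^sub>D z = 0" "z \<turnstile>\<^sub>D 0 = 0" "0 \<stileturn>\<^sub>D z = 0" "z \<stileturn>\<^sub>D 0 = 0"
    by (fact a.add b.add c.add d.add a.diff b.diff c.diff d.diff
        a.scale b.scale c.scale d.scale a.zero b.zero c.zero d.zero)+
qed

lemma zero_in_sum_of_sets:
  fixes F :: "nat \<Rightarrow> 'a set"
  assumes "finite I" "\<And>i. i \<in> I \<Longrightarrow> 0 \<in> F i"
  shows "0 \<in> (\<Sum>i\<in>I. F i)"
  using assms
proof (induction I rule: finite_induct)
  case (insert i I)
  then show ?case using set_plus_intro[of 0 "F i" 0 "sum F I"] by simp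
qed simp

lemma subset_sum_of_sets:
  fixes F :: "nat \<Rightarrow> 'a set"
  assumes "finite I" "\<And>i. i \<in> I \<Longrightarrow> 0 \<in> F i" "j \<in> I"
  shows "F j \<subseteq> (\<Sum>i\<in>I. F i)"
proof
  fix x assume x: "x \<in> F j"
  have "0 \<in> (\<Sum>i\<in>I - {j}. F i)"
    by (rule zero_in_sum_of_sets) (use assms in auto)
  then have "x + 0 \<in> F j + (\<Sum>i\<in>I - {j}. F i)"
    by (rule set_plus_intro[OF x])
  then show "x \<in> (\<Sum>i\<in>I. F i)"
    by (simp add: sum.remove[OF assms(1,3)])
qed

lemma sum_of_sets_subset_subspace:
  fixes F :: "nat \<Rightarrow> 'a set"
  assumes "finite I" "subspace T" "\<And>i. i \<in> I \<Longrightarrow> F i \<subseteq> T"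
  shows "(\<Sum>i\<in>I. F i) \<subseteq> T"
  using assms(1,3)
proof (induction I rule: finite_induct)
  case empty
  then show ?case using assms(2) by (simp add: subspace_0)
next
  case (insert i I)
  then show ?case
    using subspace_add[OF assms(2)] by (auto elim!: set_plus_elim) blast
qed

lemma lozenge_memI:
  assumes "a \<in> A" "b \<in> B"
  shows "a \<turnstile>\<^sub>D b \<in> A \<lozenge> B" "a \<stileturn>\<^sub>D b \<in> A \<lozenge> B"
proof -
  have l: "a \<turnstile>\<^sub>D b \<in> lp_span A B" and r: "a \<stileturn>\<^sub>D b \<in> rp_span A B"
    unfolding lp_span_def rp_span_def using assms by (blast intro: span_base)+
  have "0 \<in> lp_span A B" "0 \<in> rp_span A B"
    unfolding lp_span_def rp_span_def by (rule span_zero)+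
  with l r show "a \<turnstile>\<^sub>D b \<in> A \<lozenge> B" "a \<stileturn>\<^sub>D b \<in> A \<lozenge> B"
    unfolding lozenge_def
    using set_plus_intro[OF l, of 0 "rp_span A B"] set_plus_intro[of 0 "lp_span A B", OF _ r] by auto
qed

lemma lozenge_subset_subspace:
  assumes "subspace T" "\<And>a b. a \<in> A \<Longrightarrow> b \<in> B \<Longrightarrow> a \<turnstile>\<^sub>D b \<in> T \<and> a \<stileturn>\<^sub>D b \<in> T"
  shows "A \<lozenge> B \<subseteq> T"
proof -
  have "lp_span A B \<subseteq> T" "rp_span A B \<subseteq> T"
    unfolding lp_span_def rp_span_def by (rule span_minimal; use assms in blast)+
  then show ?thesis
    unfolding lozenge_def using subspace_add[OF assms(1)] by (auto elim!: set_plus_elim)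
qed

lemma zero_in_lozenge: "0 \<in> A \<lozenge> B"
  unfolding lozenge_def lp_span_def rp_span_def
  using set_plus_intro[OF span_zero span_zero] by simp

lemma Dpow_eq_sum:
  assumes "n \<ge> 2" shows "Dpow n = (\<Sum>i = 1..n - 1. Dpow i \<lozenge> Dpow (n - i))"
proof -
  obtain m where "n = Suc (Suc m)"
    using assms by (metis Suc_le_D numeral_2_eq_2 Suc_le_mono)
  then show ?thesis by simp
qed

lemma lozenge_subset_Dpow:
  assumes "i \<ge> 1" "j \<ge> 1"
  shows "Dpow i \<lozenge> Dpow j \<subseteq> Dpow (i + j)"
proof -
  have "Dpow i \<lozenge> Dpow (i + j - i) \<subseteq> (\<Sum>k = 1..i + j - 1. Dpow k \<lozenge> Dpow (i + j - k))"
    by (rule subset_sum_of_sets) (use assms in \<open>auto simp: zero_in_lozenge\<close>)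
  then show ?thesis using Dpow_eq_sum[of "i + j"] assms by simp
qed

lemma lp_in_Dpow: "\<lbrakk>i \<ge> 1; j \<ge> 1; a \<in> Dpow i; b \<in> Dpow j\<rbrakk> \<Longrightarrow> a \<turnstile>\<^sub>D b \<in> Dpow (i + j)"
  and rp_in_Dpow: "\<lbrakk>i \<ge> 1; j \<ge> 1; a \<in> Dpow i; b \<in> Dpow j\<rbrakk> \<Longrightarrow> a \<stileturn>\<^sub>D b \<in> Dpow (i + j)"
  by (auto intro: subsetD[OF lozenge_subset_Dpow] lozenge_memI)

lemma zero_in_Dpow: "0 \<in> Dpow n"
proof (cases "n \<ge> 2")
  case True
  then show ?thesis
    by (subst Dpow_eq_sum) (auto intro!: zero_in_sum_of_sets zero_in_lozenge)
next
  case False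
  then have "n = 0 \<or> n = Suc 0" by auto
  then show ?thesis by auto
qed

text \<open>The induction scheme for the powers: a subspace contains \<open>D\<^sup>n\<close> once it contains the
  products that generate it.\<close>

lemma Dpow_subset_subspace:
  assumes "n \<ge> 2" "subspace T"
    and "\<And>i j a b. \<lbrakk>i \<ge> 1; j \<ge> 1; i + j = n; a \<in> Dpow i; b \<in> Dpow j\<rbrakk>
      \<Longrightarrow> a \<turnstile>\<^sub>D b \<in> T \<and> a \<stileturn>\<^sub>D b \<in> T"
  shows "Dpow n \<subseteq> T"
  unfolding Dpow_eq_sum[OF assms(1)]
proof (rule sum_of_sets_subset_subspace)
  fix i assume "i \<in> {1..n - 1}"
  then have "i \<ge> 1" "n - i \<ge> 1" "i + (n - i) = n" using assms(1) by auto
  then show "Dpow i \<lozenge> Dpow (n - i) \<subseteq> T"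
    using assms(3) by (intro lozenge_subset_subspace[OF assms(2)]) blast
qed (use assms in auto)

section \<open>The colon filtration of an invariant subspace\<close>

text \<open>The vectors that every \<open>n\<close>-fold left multiplication sends into \<open>B\<close>, that is, the colon
  subspace \<open>(B : D\<^sup>n)\<close> with respect to \<open>\<turnstile>\<close>.\<close>

primrec left_colon :: "'a set \<Rightarrow> nat \<Rightarrow> 'a set" where
  "left_colon B 0 = B"
| "left_colon B (Suc n) = {v. \<forall>d. d \<turnstile>\<^sub>D v \<in> left_colon B n}"

definition left_invariant :: "'a set \<Rightarrow> bool" where
  "left_invariant B \<longleftrightarrow> subspace B \<and> (\<forall>d. \<forall>v\<in>B. d \<turnstile>\<^sub>D v \<in> B)"

lemma left_invariant_zero: "left_invariant {0}"
  by (auto simp: left_invariant_def bilinear_simps intro: subspace_single_0)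

lemma left_invariant_left_colon:
  assumes "left_invariant B"
  shows "left_invariant (left_colon B n)"
proof (induction n)
  case 0
  then show ?case using assms by simp
next
  case (Suc n)
  then have s: "subspace (left_colon B n)" and i: "\<And>d v. v \<in> left_colon B n \<Longrightarrow> d \<turnstile>\<^sub>D v \<in> left_colon B n"
    by (auto simp: left_invariant_def)
  have "subspace (left_colon B (Suc n))"
    by (rule subspaceI)
      (auto simp: bilinear_simps subspace_0[OF s] subspace_add[OF s] subspace_scale[OF s])
  then show ?case using i by (auto simp: left_invariant_def)
qed

lemma subspace_left_colon: "left_invariant B \<Longrightarrow> subspace (left_colon B n)"
  using left_invariant_left_colon by (simp add: left_invariant_def)

lemma left_colon_mono:
  assumes "left_invariant B" "m \<le> n"
  shows "left_colon B m \<subseteq> left_colon B n"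
  using assms(2)
proof (induction rule: dec_induct)
  case (step n)
  then show ?case using left_invariant_left_colon[OF assms(1), of n]
    by (auto simp: left_invariant_def)
qed simp

lemma left_colon_mono_base: "B \<subseteq> C \<Longrightarrow> left_colon B n \<subseteq> left_colon C n"
  by (induction n) auto

text \<open>By A1 and D1, any product of \<open>n\<close> elements, whatever its form, acts from the left as \<open>n\<close>
  successive left multiplications.\<close>

lemma Dpow_lp_left_colon:
  assumes B: "left_invariant B" and "n \<ge> 1" "x \<in> Dpow n" "v \<in> left_colon B m"
  shows "x \<turnstile>\<^sub>D v \<in> left_colon B (m - n)"
  using assms(2-)
proof (induction n arbitrary: x v m rule: less_induct)
  case (less n)
  note s = subspace_left_colon[OF B]
  show ?case
  proof (cases "n = 1")
    case True
    show ?thesis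
    proof (cases m)
      case 0
      then show ?thesis using B less.prems by (auto simp: left_invariant_def)
    next
      case (Suc k)
      then show ?thesis using True less.prems by simp
    qed
  next
    case False
    with less.prems have "n \<ge> 2" by simp
    let ?T = "{x. x \<turnstile>\<^sub>D v \<in> left_colon B (m - n)}"
    have "Dpow n \<subseteq> ?T"
    proof (rule Dpow_subset_subspace[OF \<open>n \<ge> 2\<close>])
      show "subspace ?T"
        by (rule subspaceI)
          (auto simp: bilinear_simps subspace_0[OF s] subspace_add[OF s] subspace_scale[OF s])
    next
      fix i j a b
      assume ij: "i \<ge> 1" "j \<ge> 1" "i + j = n" and ab: "a \<in> Dpow i" "b \<in> Dpow j"
      have "b \<turnstile>\<^sub>D v \<in> left_colon B (m - j)"
        using less.IH[of j b v m] ij ab(2) less.prems(3) by linarith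
      then have "a \<turnstile>\<^sub>D (b \<turnstile>\<^sub>D v) \<in> left_colon B (m - j - i)"
        using less.IH[of i a "b \<turnstile>\<^sub>D v" "m - j"] ij ab(1) by linarith
      moreover have "m - j - i = m - n" using ij by simp
      ultimately show "a \<turnstile>\<^sub>D b \<in> ?T \<and> a \<stileturn>\<^sub>D b \<in> ?T"
        by (simp add: A1 D1)
    qed
    then show ?thesis using less.prems by blast
  qed
qed

section \<open>Nil left multiplications annihilate the space jointly\<close>

lemma left_mult_power_diff_in_invariant:
  assumes B: "left_invariant B" and u: "u - b \<turnstile>\<^sub>D u \<in> B"
  shows "u - (left_mult b ^^ n) u \<in> B"
proof (induction n)
  case 0
  then show ?case using B by (simp add: left_invariant_def subspace_0)
next
  case (Suc n)
  then have "(u - b \<turnstile>\<^sub>D u) + b \<turnstile>\<^sub>D (u - (left_mult b ^^ n) u) \<in> B"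
    using B u by (auto simp: left_invariant_def intro: subspace_add)
  then show ?case by (simp add: left_mult_def bilinear_simps)
qed

text \<open>Engel's step, without quotient spaces: among the \<open>w \<notin> B\<close> take one with
  \<open>D \<turnstile> w + B\<close> of least dimension. If \<open>u = a \<turnstile> w\<close> were outside \<open>B\<close>, then
  \<open>D \<turnstile> u + B\<close>, being contained in \<open>D \<turnstile> w + B\<close>, would equal it and so contain \<open>u\<close> itself:
  \<open>u\<close> would be fixed modulo \<open>B\<close> by a nilpotent left multiplication.\<close>

lemma ex_annihilated_modulo:
  assumes fd: "finite_dimensional_vector_space scale Basis"
    and nil: "\<And>d. nilpotent_endomorphism (left_mult d)"
    and B: "left_invariant B" and "B \<noteq> UNIV"
  obtains w where "w \<notin> B" "\<And>d. d \<turnstile>\<^sub>D w \<in> B"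
proof -
  interpret fd: finite_dimensional_vector_space scale Basis by (rule fd)
  define orb where "orb w = {x. \<exists>d. x - d \<turnstile>\<^sub>D w \<in> B}" for w
  have sB: "subspace B" and iB: "\<And>d v. v \<in> B \<Longrightarrow> d \<turnstile>\<^sub>D v \<in> B"
    using B by (auto simp: left_invariant_def)
  have orb: "subspace (orb w)" for w
  proof (rule subspaceI)
    have "0 - 0 \<turnstile>\<^sub>D w \<in> B" using subspace_0[OF sB] by (simp add: bilinear_simps)
    then show "0 \<in> orb w" unfolding orb_def by blast
  next
    fix x y assume "x \<in> orb w" "y \<in> orb w"
    then obtain d e where "x - d \<turnstile>\<^sub>D w \<in> B" "y - e \<turnstile>\<^sub>D w \<in> B" unfolding orb_def by blast
    then have "(x - d \<turnstile>\<^sub>D w) + (y - e \<turnstile>\<^sub>D w) \<in> B" by (rule subspace_add[OF sB])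
    then have "x + y - (d + e) \<turnstile>\<^sub>D w \<in> B" by (simp add: bilinear_simps algebra_simps)
    then show "x + y \<in> orb w" unfolding orb_def by blast
  next
    fix c x assume "x \<in> orb w"
    then obtain d where "x - d \<turnstile>\<^sub>D w \<in> B" unfolding orb_def by blast
    then have "scale c (x - d \<turnstile>\<^sub>D w) \<in> B" by (rule subspace_scale[OF sB])
    then have "scale c x - scale c d \<turnstile>\<^sub>D w \<in> B"
      by (simp add: bilinear_simps scale_right_diff_distrib)
    then show "scale c x \<in> orb w" unfolding orb_def by blast
  qed
  obtain w0 where "w0 \<notin> B" using \<open>B \<noteq> UNIV\<close> by blast
  then obtain w where w: "w \<notin> B" and min: "\<And>u. u \<notin> B \<Longrightarrow> dim (orb w) \<le> dim (orb u)"
    using ex_has_least_nat[of "\<lambda>w. w \<notin> B" w0 "\<lambda>w. dim (orb w)"] by blast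
  have "a \<turnstile>\<^sub>D w \<in> B" for a
  proof (rule ccontr)
    define u where "u = a \<turnstile>\<^sub>D w"
    assume "a \<turnstile>\<^sub>D w \<notin> B"
    then have u: "u \<notin> B" by (simp add: u_def)
    have "orb u \<subseteq> orb w"
      unfolding orb_def u_def by (auto simp flip: A1)
    then have "orb u = orb w"
      using fd.subspace_dim_equal[OF orb orb] min[OF u] by blast
    moreover have "u - a \<turnstile>\<^sub>D w \<in> B"
      using subspace_0[OF sB] by (simp add: u_def)
    then have "u \<in> orb w" unfolding orb_def by blast
    ultimately have "u \<in> orb u" by simp
    then obtain b where "u - b \<turnstile>\<^sub>D u \<in> B"
      unfolding orb_def by blast
    then have "u - (left_mult b ^^ n) u \<in> B" for n
      by (rule left_mult_power_diff_in_invariant[OF B])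
    moreover obtain n where "left_mult b ^^ n = (\<lambda>x. 0)"
      using nil[of b] by (auto simp: nilpotent_endomorphism_def)
    ultimately have "u \<in> B" by (metis diff_zero)
    with u show False by contradiction
  qed
  with w show thesis by (rule that)
qed

lemma ex_left_colon_UNIV:
  assumes fd: "finite_dimensional_vector_space scale Basis"
    and nil: "\<And>d. nilpotent_endomorphism (left_mult d)"
  obtains N where "left_colon {0} N = UNIV"
proof -
  interpret fd: finite_dimensional_vector_space scale Basis by (rule fd)
  note B = left_invariant_zero
  \<comment> \<open>Until the whole space is reached, each step of the filtration gains a dimension.\<close>
  have "left_colon {0} n = UNIV \<or> n \<le> dim (left_colon {0} n)" for n
  proof (induction n)
    case (Suc n)
    let ?V = "left_colon {0} n" and ?W = "left_colon {0} (Suc n)"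
    have le: "?V \<subseteq> ?W" by (rule left_colon_mono[OF B]) simp
    show ?case
    proof (cases "?V = UNIV")
      case True
      then show ?thesis using le by blast
    next
      case False
      then obtain w where "w \<notin> ?V" "\<And>d. d \<turnstile>\<^sub>D w \<in> ?V"
        using ex_annihilated_modulo[OF fd nil left_invariant_left_colon[OF B]] by metis
      then have "?V \<noteq> ?W" by auto
      then have "\<not> dim ?W \<le> dim ?V"
        using fd.subspace_dim_equal[OF subspace_left_colon[OF B] subspace_left_colon[OF B] le] by blast
      then show ?thesis using Suc.IH False by linarith
    qed
  qed simp
  then have "left_colon {0} (Suc (dim UNIV)) = UNIV"
    using fd.dim_subset[OF subset_UNIV] by (metis not_less_eq_eq)
  then show thesis by (rule that)
qed

section \<open>From left words to all products\<close>

text \<open>To the right of \<open>\<stileturn>\<close> both products agree (A2, D2). So modulo the right annihilator \<open>K\<close> of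
  \<open>\<stileturn>\<close>, an element of \<open>D\<^sup>n\<close> is a sum of left words with \<open>n - 1\<close> left multiplications.\<close>

lemma rp_Dpow_eq_0:
  assumes N: "left_colon {0} N = UNIV" and n: "n > N" "x \<in> Dpow n"
  shows "z \<stileturn>\<^sub>D x = 0"
proof -
  define K where "K = {x. \<forall>z. z \<stileturn>\<^sub>D x = 0}"
  have K: "left_invariant K"
    unfolding left_invariant_def K_def
    by (auto intro!: subspaceI simp: bilinear_simps simp flip: D2)
  note s = subspace_left_colon[OF K]
  have KN: "left_colon K N = UNIV"
    using left_colon_mono_base[of "{0}" K N] N subspace_0[of K] K
    by (auto simp: left_invariant_def)
  have "Dpow n \<subseteq> left_colon K (N - (n - 1))" if "n \<ge> 1" for n
    using that
  proof (induction n rule: less_induct)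
    case (less n)
    show ?case
    proof (cases "n = 1")
      case True
      then show ?thesis using KN by simp
    next
      case False
      then have "n \<ge> 2" using less.prems by simp
      then show ?thesis
      proof (rule Dpow_subset_subspace)
        fix i j a b
        assume ij: "i \<ge> 1" "j \<ge> 1" "i + j = n" and ab: "a \<in> Dpow i" "b \<in> Dpow j"
        have "b \<in> left_colon K (N - (j - 1))" using less.IH[of j] ij ab by auto
        from Dpow_lp_left_colon[OF K ij(1) ab(1) this]
        have l: "a \<turnstile>\<^sub>D b \<in> left_colon K (N - (n - 1))" using ij by (simp add: diff_diff_eq add.commute)
        have "a \<stileturn>\<^sub>D b - a \<turnstile>\<^sub>D b \<in> K"
          unfolding K_def by (simp add: bilinear_simps flip: A2 D2)
        then have "a \<stileturn>\<^sub>D b - a \<turnstile>\<^sub>D b \<in> left_colon K (N - (n - 1))"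
          using left_colon_mono[OF K, of 0] by auto
        from subspace_add[OF s this l] l
        show "a \<turnstile>\<^sub>D b \<in> left_colon K (N - (n - 1)) \<and> a \<stileturn>\<^sub>D b \<in> left_colon K (N - (n - 1))"
          by simp
      qed (rule s)
    qed
  qed
  from this[of n] n have "x \<in> K" by auto
  then show ?thesis by (simp add: K_def)
qed

text \<open>The centre of \<open>x \<stileturn> b\<close> lies in \<open>x\<close>. A nonzero product has at most \<open>N\<close> factors to the right
  of its centre. If \<open>n + j > N\<close>, at least \<open>n + j - 1 - N\<close> factors are left of it, and \<open>N\<close> minus
  this number is \<open>2 N + 1 - (n + j)\<close>; otherwise the conclusion holds for every vector.\<close>

lemma Dpow_rp_left_colon:
  assumes N: "left_colon {0} N = UNIV"
    and "n \<ge> 1" "j \<ge> 1" "x \<in> Dpow n" "b \<in> Dpow j"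
  shows "x \<stileturn>\<^sub>D b \<in> left_colon {0} (2 * N + 1 - (n + j))"
  using assms(2-)
proof (induction n arbitrary: x b j rule: less_induct)
  case (less n)
  note s = subspace_left_colon[OF left_invariant_zero]
  show ?case
  proof (cases "n = 1")
    case True
    show ?thesis
    proof (cases "j > N")
      case True
      then show ?thesis
        using rp_Dpow_eq_0[OF N True less.prems(4)] by (simp add: subspace_0[OF s])
    next
      case False
      then have "left_colon {0} N \<subseteq> left_colon {0} (2 * N + 1 - (n + j))"
        using \<open>n = 1\<close> by (intro left_colon_mono left_invariant_zero) auto
      then show ?thesis using N by auto
    qed
  next
    case False
    with less.prems have "n \<ge> 2" by simp
    let ?T = "{x. x \<stileturn>\<^sub>D b \<in> left_colon {0} (2 * N + 1 - (n + j))}"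
    have "Dpow n \<subseteq> ?T"
    proof (rule Dpow_subset_subspace[OF \<open>n \<ge> 2\<close>])
      show "subspace ?T"
        by (rule subspaceI)
          (auto simp: bilinear_simps subspace_0[OF s] subspace_add[OF s] subspace_scale[OF s])
    next
      fix i k a c
      assume ik: "i \<ge> 1" "k \<ge> 1" "i + k = n" and ac: "a \<in> Dpow i" "c \<in> Dpow k"
      have "c \<stileturn>\<^sub>D b \<in> left_colon {0} (2 * N + 1 - (k + j))"
        by (rule less.IH) (use ik ac less.prems in auto)
      from Dpow_lp_left_colon[OF left_invariant_zero ik(1) ac(1) this]
      have l: "a \<turnstile>\<^sub>D (c \<stileturn>\<^sub>D b) \<in> left_colon {0} (2 * N + 1 - (n + j))"
        using ik(3) by (simp add: ac_simps flip: ik(3))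
      have "a \<stileturn>\<^sub>D (c \<stileturn>\<^sub>D b) \<in> left_colon {0} (2 * N + 1 - (i + (k + j)))"
        by (rule less.IH) (use ik ac less.prems in \<open>auto intro: rp_in_Dpow\<close>)
      then show "a \<turnstile>\<^sub>D c \<in> ?T \<and> a \<stileturn>\<^sub>D c \<in> ?T"
        using l ik by (simp add: S1 A2 add.assoc[symmetric])
    qed
    then show ?thesis using less.prems by blast
  qed
qed

text \<open>For \<open>n = 2 N + 1\<close> the right-hand side is \<open>{0}\<close>. An induction on \<open>n\<close> alone would fail for
  the products \<open>a \<stileturn> b\<close>, where the induction hypothesis for \<open>a\<close> ignores the factors of \<open>b\<close>; these
  are the products counted by \<open>Dpow_rp_left_colon\<close>.\<close>

lemma Dpow_subset_left_colon:
  assumes N: "left_colon {0} N = UNIV" and "n \<ge> 1"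
  shows "Dpow n \<subseteq> left_colon {0} (2 * N + 1 - n)"
  using assms(2)
proof (induction n rule: less_induct)
  case (less n)
  show ?case
  proof (cases "n = 1")
    case True
    then have "left_colon {0} N \<subseteq> left_colon {0} (2 * N + 1 - n)"
      by (intro left_colon_mono left_invariant_zero) auto
    then show ?thesis using N by auto
  next
    case False
    then have "n \<ge> 2" using less.prems by simp
    then show ?thesis
    proof (rule Dpow_subset_subspace)
      fix i j a b
      assume ij: "i \<ge> 1" "j \<ge> 1" "i + j = n" and ab: "a \<in> Dpow i" "b \<in> Dpow j"
      have "b \<in> left_colon {0} (2 * N + 1 - j)" using less.IH[of j] ij ab by auto
      from Dpow_lp_left_colon[OF left_invariant_zero ij(1) ab(1) this]
        Dpow_rp_left_colon[OF N ij(1,2) ab]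
      show "a \<turnstile>\<^sub>D b \<in> left_colon {0} (2 * N + 1 - n) \<and> a \<stileturn>\<^sub>D b \<in> left_colon {0} (2 * N + 1 - n)"
        using ij by (simp add: ac_simps)
    qed (rule subspace_left_colon[OF left_invariant_zero])
  qed
qed

lemma nilpotent_algebra_if_left_mult_nilpotent:
  assumes "finite_dimensional_vector_space scale Basis"
    and "\<And>d. nilpotent_endomorphism (left_mult d)"
  shows nilpotent_algebra
proof -
  obtain N where N: "left_colon {0} N = UNIV"
    using ex_left_colon_UNIV[OF assms] .
  have "Dpow (2 * N + 1) \<subseteq> {0}"
    using Dpow_subset_left_colon[OF N, of "2 * N + 1"] by simp
  then have "Dpow (2 * N + 1) = {0}" using zero_in_Dpow by blast
  then show ?thesis
    unfolding nilpotent_algebra_def by (intro exI[of _ "2 * N + 1"] conjI) simp_all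
qed

lemma left_mult_power_in_Dpow: "(left_mult d ^^ n) x \<in> Dpow (Suc n)"
proof (induction n)
  case 0
  then show ?case by simp
next
  case (Suc n)
  then show ?case
    using lp_in_Dpow[of 1 "Suc n" d "(left_mult d ^^ n) x"] by (simp add: left_mult_def)
qed

lemma left_mult_nilpotent_if_nilpotent_algebra:
  assumes nilpotent_algebra
  shows "nilpotent_endomorphism (left_mult d)"
proof -
  obtain n where n: "n \<ge> 1" "Dpow n = {0}"
    using assms unfolding nilpotent_algebra_def by blast
  obtain m where m: "n = Suc m" using n(1) by (metis One_nat_def Suc_le_D)
  have "(left_mult d ^^ m) x = 0" for x
    using left_mult_power_in_Dpow[where n = m and d = d and x = x] n(2) unfolding m by blast
  then have "left_mult d ^^ n = (\<lambda>x. 0)"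
    by (simp add: m fun_eq_iff left_mult_def bilinear_simps)
  moreover have "Vector_Spaces.linear scale scale (left_mult d)"
    unfolding left_mult_def by (rule lp_linear_right)
  ultimately show ?thesis
    unfolding nilpotent_endomorphism_def using n(1) by blast
qed

end

theorem corollary4p1:
  fixes scale :: "'k::field \<Rightarrow> 'a::ab_group_add \<Rightarrow> 'a"
    and lp rp :: "'a \<Rightarrow> 'a \<Rightarrow> 'a"
    and Basis :: "'a set"
  assumes "diassociative_algebra scale lp rp"
    and "finite_dimensional_vector_space scale Basis"
  shows "diassociative_algebra.nilpotent_algebra scale lp rp \<longleftrightarrow>
    (\<forall>d. diassociative_algebra.nilpotent_endomorphism scale
           (diassociative_algebra.left_mult lp d))"
proof -
  interpret diassociative_algebra scale lp rp by (rule assms(1))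
  show ?thesis
  proof
    assume nilpotent_algebra
    then show "\<forall>d. nilpotent_endomorphism (left_mult d)"
      using left_mult_nilpotent_if_nilpotent_algebra by simp
  next
    assume "\<forall>d. nilpotent_endomorphism (left_mult d)"
    then show nilpotent_algebra
      by (intro nilpotent_algebra_if_left_mult_nilpotent[OF assms(2)]) (rule spec)
  qed
qed

end
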